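(* Consider GPDMM (defined in the context) for $\min\sum_{i=1}^m f_i(\boldsymbol{x}_i)$ s.t. $\boldsymbol{x}_s=\boldsymbol{x}_i$, $i=1,\ldots,m$, with parameters $\rho>0$, $\eta>0$ and $K\ge 1$, and suppose that $1/\eta> L\geq \mu>0$. Let $\theta,\phi$ be real numbers with $0<\theta<1$, $0<\phi<1$ and $\frac{\theta\mu\phi}{4\rho^2}<\frac{1}{4\rho}$. Define $$\gamma_1=\min\left(\frac{1-\theta}{2L\eta^2},\ \frac{1/\eta-L}{2}\right),\qquad \gamma_2=\min\left(\frac{\theta\mu\phi}{2\rho^2},\ \frac{\gamma_1\eta^2}{2}\right),$$ and for $r\geq 1$ $$Q^r=\sum_{i=1}^m\left[\frac{1/\eta-\theta\mu}{2K}\,\|\boldsymbol{x}_i^{r-1,K}-\boldsymbol{x}_i^{\star}\|^2+\Big(\frac{1}{4\rho}-\frac{\gamma_2}{2}\Big)\big\|\rho(\bar{\boldsymbol{x}}_i^{r,K}-\boldsymbol{x}_i^{\star})+(\boldsymbol{\lambda}_{i|s}^{r+1}-\boldsymbol{\lambda}_{i|s}^{\star})\big\|^2\right].$$ Then, for all $r\ge 1$, $$Q^{r+1}\leq \beta\, Q^r,\qquad \text{where}\qquad \beta=\max\left(\frac{1/(4\rho)-\gamma_2/2}{1/(4\rho)},\ \frac{1/\eta-\theta\mu}{1/\eta-\theta\mu\phi}\right),$$ and $0<\beta<1$.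
   Context: Problem. $m\geq1$, $d\ge 1$. Each $f_i:\mathbb{R}^d\to\mathbb{R}$ ($i=1,\ldots,m$) is continuously differentiable, and for constants $L>0$, $\mu\ge 0$ satisfies, for all $\boldsymbol{x},\boldsymbol{y}\in\mathbb{R}^d$, $f_i(\boldsymbol{y})\ge f_i(\boldsymbol{x})+\nabla f_i(\boldsymbol{x})^T(\boldsymbol{y}-\boldsymbol{x})+\frac{1}{2L}\|\nabla f_i(\boldsymbol{x})-\nabla f_i(\boldsymbol{y})\|^2$ and $f_i(\boldsymbol{y})\ge f_i(\boldsymbol{x})+\nabla f_i(\boldsymbol{x})^T(\boldsymbol{y}-\boldsymbol{x})+\frac{\mu}{2}\|\boldsymbol{x}-\boldsymbol{y}\|^2$. Norms are Euclidean. Optimal solution. It is assumed that there exist $\boldsymbol{x}_s^{\star}$, $\{\boldsymbol{x}_i^{\star}\}$, $\{\boldsymbol{\lambda}_{i|s}^{\star}\}$ in $\mathbb{R}^d$ satisfying the KKT conditions $\boldsymbol{x}_i^{\star}=\boldsymbol{x}_s^{\star}$ and $\nabla f_i(\boldsymbol{x}_i^{\star})=\boldsymbol{\lambda}_{i|s}^{\star}$ for all $i$, and $\sum_{i=1}^m\boldsymbol{\lambda}_{i|s}^{\star}=0$; such a choice is fixed. GPDMM. Initialise with $\boldsymbol{x}_s^{1}\in\mathbb{R}^d$, $\boldsymbol{x}_i^{0,K}=\boldsymbol{x}_s^1$, $\boldsymbol{\lambda}_{s|i}^1=0$ for all $i$. For $r=1,2,\ldots$: each client $i$ sets $\boldsymbol{x}_i^{r,0}=\boldsymbol{x}_i^{r-1,K}$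 and for $k=0,\ldots,K-1$ computes $$\boldsymbol{x}_i^{r,k+1}=\boldsymbol{x}_i^{r,k}-\frac{1}{1/\eta+\rho}\big[\nabla f_i(\boldsymbol{x}_i^{r,k})+\rho(\boldsymbol{x}_i^{r,k}-\boldsymbol{x}_s^r)+\boldsymbol{\lambda}_{s|i}^r\big];$$ it then sets $\bar{\boldsymbol{x}}_i^{r,K}=\frac1K\sum_{k=1}^K\boldsymbol{x}_i^{r,k}$ and $\boldsymbol{\lambda}_{i|s}^{r+1}=\rho(\boldsymbol{x}_s^r-\bar{\boldsymbol{x}}_i^{r,K})-\boldsymbol{\lambda}_{s|i}^r$. The server sets $\boldsymbol{x}_s^{r+1}=\frac1m\sum_{i=1}^m(\bar{\boldsymbol{x}}_i^{r,K}-\boldsymbol{\lambda}_{i|s}^{r+1}/\rho)$ and $\boldsymbol{\lambda}_{s|i}^{r+1}=\rho(\bar{\boldsymbol{x}}_i^{r,K}-\boldsymbol{x}_s^{r+1})-\boldsymbol{\lambda}_{i|s}^{r+1}$. *)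

theory Defs
  imports "HOL-Analysis.Analysis"
begin

text \<open>The gradient \<open>g\<close> of \<open>f\<close> is carried as an explicit argument. The last two
  conjuncts are the co-coercivity-type bound with constant \<open>L\<close> and strong convexity
  with constant \<open>\<mu>\<close>.\<close>

definition admissible_objective ::
  "real \<Rightarrow> real \<Rightarrow> (real ^ 'd \<Rightarrow> real) \<Rightarrow> (real ^ 'd \<Rightarrow> real ^ 'd) \<Rightarrow> bool" where
  "admissible_objective L \<mu> f g \<longleftrightarrow>
     (\<forall>x. GDERIV f x :> g x) \<and> continuous_on UNIV g \<and>
     (\<forall>x y. f y \<ge> f x + g x \<bullet> (y - x) + 1 / (2 * L) * (norm (g x - g y))\<^sup>2) \<and>
     (\<forall>x y. f y \<ge> f x + g x \<bullet> (y - x) + \<mu> / 2 * (norm (x - y))\<^sup>2)"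

definition kkt ::
  "nat \<Rightarrow> (nat \<Rightarrow> real ^ 'd \<Rightarrow> real ^ 'd) \<Rightarrow> real ^ 'd \<Rightarrow> (nat \<Rightarrow> real ^ 'd) \<Rightarrow>
   (nat \<Rightarrow> real ^ 'd) \<Rightarrow> bool" where
  "kkt m g xs_opt x_opt lam_opt \<longleftrightarrow>
     (\<forall>i\<in>{1..m}. x_opt i = xs_opt \<and> g i (x_opt i) = lam_opt i) \<and>
     (\<Sum>i=1..m. lam_opt i) = 0"

text \<open>Client iterates are written \<open>x i r k\<close> (client, round, local step);
  \<open>lam_is i r\<close> and \<open>lam_si i r\<close> are the client-to-server and server-to-client dual
  variables \<open>\<lambda>\<^sub>i\<^sub>|\<^sub>s\<close> and \<open>\<lambda>\<^sub>s\<^sub>|\<^sub>i\<close> with round index \<open>r\<close>.\<close>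

definition client_avg :: "nat \<Rightarrow> (nat \<Rightarrow> nat \<Rightarrow> nat \<Rightarrow> real ^ 'd) \<Rightarrow> nat \<Rightarrow> nat \<Rightarrow> real ^ 'd" where
  "client_avg K x i r = (1 / real K) *\<^sub>R (\<Sum>k=1..K. x i r k)"

text \<open>The sequences form a run of the algorithm. Entries outside \<open>i \<in> {1..m}\<close>,
  \<open>k \<le> K\<close>, the entries \<open>x i 0 k\<close> with \<open>k \<noteq> K\<close>, and the dual and
  server entries preceding their initialisation or first update are unconstrained;
  all other entries are uniquely determined by \<open>xs 1\<close>.\<close>

definition gpdmm_run ::
  "nat \<Rightarrow> nat \<Rightarrow> real \<Rightarrow> real \<Rightarrow> (nat \<Rightarrow> real ^ 'd \<Rightarrow> real ^ 'd) \<Rightarrow>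
   (nat \<Rightarrow> nat \<Rightarrow> nat \<Rightarrow> real ^ 'd) \<Rightarrow> (nat \<Rightarrow> real ^ 'd) \<Rightarrow>
   (nat \<Rightarrow> nat \<Rightarrow> real ^ 'd) \<Rightarrow> (nat \<Rightarrow> nat \<Rightarrow> real ^ 'd) \<Rightarrow> bool" where
  "gpdmm_run m K \<eta> \<rho> g x xs lam_is lam_si \<longleftrightarrow>
     (\<forall>i\<in>{1..m}. x i 0 K = xs 1 \<and> lam_si i 1 = 0) \<and>
     (\<forall>r\<ge>1.
        (\<forall>i\<in>{1..m}.
           x i r 0 = x i (r - 1) K \<and>
           (\<forall>k<K. x i r (k + 1) = x i r k - (1 / (1 / \<eta> + \<rho>)) *\<^sub>R
              (g i (x i r k) + \<rho> *\<^sub>R (x i r k - xs r) + lam_si i r)) \<and>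
           lam_is i (r + 1) = \<rho> *\<^sub>R (xs r - client_avg K x i r) - lam_si i r) \<and>
        xs (r + 1) = (1 / real m) *\<^sub>R
          (\<Sum>i=1..m. client_avg K x i r - (1 / \<rho>) *\<^sub>R lam_is i (r + 1)) \<and>
        (\<forall>i\<in>{1..m}.
           lam_si i (r + 1) = \<rho> *\<^sub>R (client_avg K x i r - xs (r + 1)) - lam_is i (r + 1)))"

definition gamma1 :: "real \<Rightarrow> real \<Rightarrow> real \<Rightarrow> real" where
  "gamma1 L \<eta> \<theta> = min ((1 - \<theta>) / (2 * L * \<eta>\<^sup>2)) ((1 / \<eta> - L) / 2)"

definition gamma2 :: "real \<Rightarrow> real \<Rightarrow> real \<Rightarrow> real \<Rightarrow> real \<Rightarrow> real \<Rightarrow> real" where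
  "gamma2 L \<mu> \<eta> \<rho> \<theta> \<phi> =
     min (\<theta> * \<mu> * \<phi> / (2 * \<rho>\<^sup>2)) (gamma1 L \<eta> \<theta> * \<eta>\<^sup>2 / 2)"

definition beta_rate :: "real \<Rightarrow> real \<Rightarrow> real \<Rightarrow> real \<Rightarrow> real \<Rightarrow> real \<Rightarrow> real" where
  "beta_rate L \<mu> \<eta> \<rho> \<theta> \<phi> =
     max ((1 / (4 * \<rho>) - gamma2 L \<mu> \<eta> \<rho> \<theta> \<phi> / 2) / (1 / (4 * \<rho>)))
         ((1 / \<eta> - \<theta> * \<mu>) / (1 / \<eta> - \<theta> * \<mu> * \<phi>))"

definition Q_fun ::
  "nat \<Rightarrow> nat \<Rightarrow> real \<Rightarrow> real \<Rightarrow> real \<Rightarrow> real \<Rightarrow> real \<Rightarrow> real \<Rightarrow>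
   (nat \<Rightarrow> nat \<Rightarrow> nat \<Rightarrow> real ^ 'd) \<Rightarrow> (nat \<Rightarrow> nat \<Rightarrow> real ^ 'd) \<Rightarrow>
   (nat \<Rightarrow> real ^ 'd) \<Rightarrow> (nat \<Rightarrow> real ^ 'd) \<Rightarrow> nat \<Rightarrow> real" where
  "Q_fun m K L \<mu> \<eta> \<rho> \<theta> \<phi> x lam_is x_opt lam_opt r =
     (\<Sum>i=1..m.
        (1 / \<eta> - \<theta> * \<mu>) / (2 * real K) * (norm (x i (r - 1) K - x_opt i))\<^sup>2 +
        (1 / (4 * \<rho>) - gamma2 L \<mu> \<eta> \<rho> \<theta> \<phi> / 2) *
          (norm (\<rho> *\<^sub>R (client_avg K x i r - x_opt i) + (lam_is i (r + 1) - lam_opt i)))\<^sup>2)"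

end

theory Submission
  imports Defs
begin

text \<open>Write \<open>Z\<^sub>i\<close> for the vector \<open>\<rho> (x\<^sub>s - x\<^sub>i\<^sup>*) - \<lambda>\<^sub>s\<^sub>|\<^sub>i - \<lambda>\<^sub>i\<^sub>|\<^sub>s\<^sup>*\<close> at the start of a round and \<open>W\<^sub>i\<close> for
  \<open>\<rho> (xbar\<^sub>i - x\<^sub>i\<^sup>*) - (\<lambda>\<^sub>i\<^sub>|\<^sub>s - \<lambda>\<^sub>i\<^sub>|\<^sub>s\<^sup>*)\<close> at its end. By the dual update, \<open>Z\<^sub>i\<close> is the
  vector \<open>\<rho> (xbar\<^sub>i - x\<^sub>i\<^sup>*) + (\<lambda>\<^sub>i\<^sub>|\<^sub>s - \<lambda>\<^sub>i\<^sub>|\<^sub>s\<^sup>*)\<close> of \<open>Q\<^sup>r\<close>. The server update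
  maps \<open>(W\<^sub>i)\<close> to the next \<open>(Z\<^sub>i)\<close> by \<open>w \<mapsto> 2 mean(w) - w\<close>, a reflection, so the sum of squares is
  preserved. Within a round, mixing the two lower bounds on \<open>f\<^sub>i\<close> with weights \<open>\<theta>\<close>, \<open>1 - \<theta>\<close>
  and averaging over the local steps bounds \<open>(xbar\<^sub>i - x\<^sub>i\<^sup>*) \<bullet> (\<lambda>\<^sub>i\<^sub>|\<^sub>s - \<lambda>\<^sub>i\<^sub>|\<^sub>s\<^sup>*)
  = (\<bar>Z\<^sub>i\<bar>\<^sup>2 - \<bar>W\<^sub>i\<bar>\<^sup>2) / (4 \<rho>)\<close> from below. The remaining quadratic terms
  in \<open>xbar\<^sub>i - x\<^sub>i\<^sup>*\<close> and \<open>\<lambda>\<^sub>i\<^sub>|\<^sub>s - \<lambda>\<^sub>i\<^sub>|\<^sub>s\<^sup>*\<close> recombine by the parallelogram law into a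
  multiple of \<open>\<bar>Z\<^sub>i\<bar>\<^sup>2 + \<bar>W\<^sub>i\<bar>\<^sup>2\<close>, which gives the contraction.\<close>

section \<open>Squared norms of a family about its mean\<close>

text \<open>Jensen for the squared norm: the two sides differ by the sum of squared deviations from
  the mean.\<close>

lemma norm_mean_power2_le:
  fixes e :: "'b \<Rightarrow> 'a::real_inner"
  assumes "finite S" and "S \<noteq> {}"
  shows "real (card S) * (norm ((1 / real (card S)) *\<^sub>R sum e S))\<^sup>2 \<le> (\<Sum>k\<in>S. (norm (e k))\<^sup>2)"
proof -
  define n where "n = real (card S)"
  define c where "c = (1 / n) *\<^sub>R sum e S"
  have n: "n > 0" using assms by (simp add: n_def card_gt_0_iff)
  have sum_e: "sum e S = n *\<^sub>R c" using n by (simp add: c_def)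
  have "0 \<le> (\<Sum>k\<in>S. (norm (e k - c))\<^sup>2)" by (simp add: sum_nonneg)
  also have "\<dots> = (\<Sum>k\<in>S. (norm (e k))\<^sup>2 + (norm c)\<^sup>2 - 2 * (e k \<bullet> c))"
    by (intro sum.cong refl)
      (simp add: power2_norm_eq_inner inner_diff_left inner_diff_right inner_commute)
  also have "\<dots> = (\<Sum>k\<in>S. (norm (e k))\<^sup>2) + n * (norm c)\<^sup>2 - 2 * (sum e S \<bullet> c)"
    by (simp add: sum.distrib sum_subtractf sum_distrib_left[symmetric] inner_sum_left n_def)
  also have "\<dots> = (\<Sum>k\<in>S. (norm (e k))\<^sup>2) - n * (norm c)\<^sup>2"
    by (simp add: sum_e power2_norm_eq_inner)
  finally show ?thesis by (simp add: n_def c_def)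
qed

text \<open>On expanding, the cross terms \<open>4 * (w i \<bullet> c)\<close> add up to
  \<open>4 * n * (norm c)\<^sup>2\<close>, which cancels the squares contributed by the
  mean.\<close>

lemma sum_norm_power2_reflect_mean:
  fixes w :: "'b \<Rightarrow> 'a::real_inner"
  assumes "finite S" and "S \<noteq> {}"
  shows "(\<Sum>i\<in>S. (norm (2 *\<^sub>R ((1 / real (card S)) *\<^sub>R sum w S) - w i))\<^sup>2) = (\<Sum>i\<in>S. (norm (w i))\<^sup>2)"
proof -
  define n where "n = real (card S)"
  define c where "c = (1 / n) *\<^sub>R sum w S"
  have n: "n > 0" using assms by (simp add: n_def card_gt_0_iff)
  have sum_w: "sum w S = n *\<^sub>R c" using n by (simp add: c_def)
  have "(\<Sum>i\<in>S. (norm (2 *\<^sub>R c - w i))\<^sup>2)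
      = (\<Sum>i\<in>S. (norm (w i))\<^sup>2 + 4 * (norm c)\<^sup>2 - 4 * (w i \<bullet> c))"
    by (intro sum.cong refl)
      (simp add: power2_norm_eq_inner inner_diff_left inner_diff_right inner_commute)
  also have "\<dots> = (\<Sum>i\<in>S. (norm (w i))\<^sup>2) + n * (4 * (norm c)\<^sup>2) - 4 * (sum w S \<bullet> c)"
    by (simp add: sum.distrib sum_subtractf sum_distrib_left[symmetric] inner_sum_left n_def)
  also have "\<dots> = (\<Sum>i\<in>S. (norm (w i))\<^sup>2)"
    by (simp add: sum_w power2_norm_eq_inner)
  finally show ?thesis by (simp add: n_def c_def)
qed

section \<open>Inequalities for a single objective\<close>

text \<open>Descent lemma. The co-coercivity bound is taken with base point \<open>v\<close>, and
  completing the square in \<open>(g v - g u) - L *\<^sub>R (v - u)\<close> moves the gradient from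
  \<open>v\<close> to \<open>u\<close>.\<close>

lemma admissible_objective_smooth:
  assumes "admissible_objective L \<mu> f g" and "L > 0"
  shows "f v \<le> f u + g u \<bullet> (v - u) + L / 2 * (norm (u - v))\<^sup>2"
proof -
  have "f u \<ge> f v + g v \<bullet> (u - v) + 1 / (2 * L) * (norm (g v - g u))\<^sup>2"
    using assms by (simp add: admissible_objective_def)
  moreover have "0 \<le> 1 / (2 * L) * (norm ((g v - g u) - L *\<^sub>R (v - u)))\<^sup>2"
    using assms by simp
  moreover have "1 / (2 * L) * (norm (p - L *\<^sub>R q))\<^sup>2
      = 1 / (2 * L) * (norm p)\<^sup>2 - p \<bullet> q + L / 2 * (norm q)\<^sup>2" for p q :: "real ^ 'a"
    using assms(2) unfolding power2_norm_eq_inner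
    by (simp add: inner_diff_left inner_diff_right inner_commute) (simp add: field_simps)
  ultimately show ?thesis
    by (simp add: inner_diff_left inner_diff_right norm_minus_commute)
qed

text \<open>Three estimates are added so that all values of \<open>f\<close> cancel: a lower bound
  on the Bregman distance \<open>R\<close> from \<open>a\<close> to \<open>u\<close>, the descent
  bound on \<open>f v\<close> from \<open>u\<close>, and the convexity bound on \<open>f v\<close>
  from \<open>a\<close>.\<close>

lemma admissible_objective_three_point:
  assumes adm: "admissible_objective L \<mu> f g" and L: "L > 0"
    and "0 \<le> \<theta>" and "\<theta> \<le> 1" and "\<mu> \<ge> 0"
  shows "(g u - g a) \<bullet> (v - a) \<ge> \<theta> * \<mu> / 2 * (norm (u - a))\<^sup>2
    + (1 - \<theta>) / (2 * L) * (norm (g u - g a))\<^sup>2 - L / 2 * (norm (u - v))\<^sup>2"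
proof -
  define R where "R = f a - f u - g u \<bullet> (a - u)"
  have R1: "R \<ge> 1 / (2 * L) * (norm (g u - g a))\<^sup>2" and R2: "R \<ge> \<mu> / 2 * (norm (u - a))\<^sup>2"
    using adm by (auto simp: admissible_objective_def R_def algebra_simps)
  have "(1 - \<theta>) * R \<ge> (1 - \<theta>) * (1 / (2 * L) * (norm (g u - g a))\<^sup>2)"
    and "\<theta> * R \<ge> \<theta> * (\<mu> / 2 * (norm (u - a))\<^sup>2)"
    using mult_left_mono[OF R1, of "1 - \<theta>"] mult_left_mono[OF R2, of \<theta>] assms by simp_all
  then have "R \<ge> \<theta> * \<mu> / 2 * (norm (u - a))\<^sup>2 + (1 - \<theta>) / (2 * L) * (norm (g u - g a))\<^sup>2"
    by (simp add: algebra_simps)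
  moreover have "f v \<le> f u + g u \<bullet> (v - u) + L / 2 * (norm (u - v))\<^sup>2"
    using admissible_objective_smooth[OF adm L] .
  moreover have "f v \<ge> f a + g a \<bullet> (v - a)"
  proof -
    have "f v \<ge> f a + g a \<bullet> (v - a) + \<mu> / 2 * (norm (a - v))\<^sup>2"
      using adm by (simp add: admissible_objective_def)
    moreover have "\<mu> / 2 * (norm (a - v))\<^sup>2 \<ge> 0" using assms by simp
    ultimately show ?thesis by linarith
  qed
  ultimately show ?thesis
    by (simp add: R_def inner_diff_left inner_diff_right)
qed

section \<open>One local step and one round of a client\<close>

text \<open>In use, \<open>u\<close> and \<open>v\<close> are consecutive local iterates,
  \<open>a\<close> is the optimum and \<open>l\<close> the dual error at \<open>v\<close>.
  Polarizing \<open>(u - v) \<bullet> (v - a)\<close> yields the squared distances. The two caps on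
  \<open>c\<close> let the surplus in \<open>u - v\<close> and in the gradient difference pay for
  the term in \<open>l\<close>.\<close>

lemma client_step:
  assumes adm: "admissible_objective L \<mu> f g"
    and "L > 0" and "\<mu> \<ge> 0" and "0 \<le> \<theta>" and "\<theta> \<le> 1" and "\<eta> > 0"
    and c1: "c \<le> (1 - \<theta>) / (2 * L * \<eta>\<^sup>2)" and c2: "c \<le> (1 / \<eta> - L) / 2" and "c \<ge> 0"
    and step: "g u - g a = (1 / \<eta>) *\<^sub>R (u - v) + l"
  shows "l \<bullet> (v - a) \<ge> 1 / (2 * \<eta>) * (norm (v - a))\<^sup>2 - (1 / \<eta> - \<theta> * \<mu>) / 2 * (norm (u - a))\<^sup>2
     + c * \<eta>\<^sup>2 / 2 * (norm l)\<^sup>2"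
proof -
  define G where "G = g u - g a"
  define p where "p = (norm (u - v))\<^sup>2"
  have three: "G \<bullet> (v - a) \<ge> \<theta> * \<mu> / 2 * (norm (u - a))\<^sup>2
      + (1 - \<theta>) / (2 * L) * (norm G)\<^sup>2 - L / 2 * p"
    unfolding G_def p_def using assms(2-5) by (intro admissible_objective_three_point[OF adm])
  have "G \<bullet> (v - a) = l \<bullet> (v - a) + 1 / (2 * \<eta>) * ((norm (u - a))\<^sup>2 - (norm (v - a))\<^sup>2 - p)"
    using \<open>\<eta> > 0\<close> unfolding G_def step p_def power2_norm_eq_inner
    by (simp add: inner_diff_left inner_diff_right inner_add_left inner_add_right inner_commute)
      (simp add: field_simps)
  moreover have "c * \<eta>\<^sup>2 / 2 * (norm l)\<^sup>2 \<le> c * p + c * \<eta>\<^sup>2 * (norm G)\<^sup>2"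
  proof -
    have l: "\<eta> *\<^sub>R l = \<eta> *\<^sub>R G - (u - v)"
      using \<open>\<eta> > 0\<close> by (simp add: G_def step algebra_simps)
    have "\<eta>\<^sup>2 * (norm l)\<^sup>2 = (norm (\<eta> *\<^sub>R l))\<^sup>2" by (simp add: power_mult_distrib)
    \<comment> \<open>Parallelogram law; dropping the subtracted square leaves the factor 2.\<close>
    also have "\<dots> = 2 * ((norm (\<eta> *\<^sub>R G))\<^sup>2 + p) - (norm (\<eta> *\<^sub>R G + (u - v)))\<^sup>2"
      unfolding l p_def power2_norm_eq_inner
      by (simp only: inner_diff_left inner_diff_right inner_add_left inner_add_right inner_commute)
        (simp add: algebra_simps)
    also have "\<dots> \<le> 2 * (\<eta>\<^sup>2 * (norm G)\<^sup>2 + p)" by (simp add: power_mult_distrib)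
    finally have "c / 2 * (\<eta>\<^sup>2 * (norm l)\<^sup>2) \<le> c / 2 * (2 * (\<eta>\<^sup>2 * (norm G)\<^sup>2 + p))"
      using \<open>c \<ge> 0\<close> by (intro mult_left_mono) auto
    then show ?thesis by (simp add: algebra_simps)
  qed
  moreover have "c * p \<le> (1 / \<eta> - L) / 2 * p"
    using c2 by (intro mult_right_mono) (auto simp: p_def)
  moreover have "c * \<eta>\<^sup>2 * (norm G)\<^sup>2 \<le> (1 - \<theta>) / (2 * L) * (norm G)\<^sup>2"
  proof -
    have "c * \<eta>\<^sup>2 \<le> (1 - \<theta>) / (2 * L * \<eta>\<^sup>2) * \<eta>\<^sup>2" using c1 by (intro mult_right_mono) auto
    also have "\<dots> = (1 - \<theta>) / (2 * L)" using \<open>\<eta> > 0\<close> by simp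
    finally show ?thesis by (intro mult_right_mono) auto
  qed
  ultimately show ?thesis using three by (simp add: algebra_simps diff_divide_distrib)
qed

text \<open>In use, \<open>z\<close> is \<open>\<rho> *\<^sub>R xs r - lam_si i r\<close>, constant
  during the round, so \<open>z - \<rho> *\<^sub>R b\<close> is the new client dual;
  \<open>c\<close> and \<open>d\<close> are \<open>gamma1\<close> and \<open>gamma2\<close>. The
  per-step bounds telescope over the round and are divided by \<open>K\<close>.\<close>

lemma client_round:
  fixes y :: "nat \<Rightarrow> real ^ 'd" and a b z :: "real ^ 'd"
  assumes adm: "admissible_objective L \<mu> f g"
    and "K \<ge> 1" and "L > 0" and "\<mu> \<ge> 0" and "0 \<le> \<theta>" and "\<theta> \<le> 1" and "0 < \<eta>" and "0 < \<rho>"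
    and "0 \<le> \<phi>" and "\<phi> \<le> 1"
    and "c \<le> (1 - \<theta>) / (2 * L * \<eta>\<^sup>2)" and "c \<le> (1 / \<eta> - L) / 2" and "c \<ge> 0"
    and "d \<ge> 0" and d1: "d \<le> \<theta> * \<mu> * \<phi> / (2 * \<rho>\<^sup>2)" and d2: "d \<le> c * \<eta>\<^sup>2 / 2"
    and step: "\<And>k. k < K \<Longrightarrow> g (y k) = (1 / \<eta>) *\<^sub>R (y k - y (Suc k)) + (z - \<rho> *\<^sub>R y (Suc k))"
    and b_def: "b = (1 / real K) *\<^sub>R (\<Sum>k=1..K. y k)"
  defines "Z \<equiv> \<rho> *\<^sub>R (b - a) + ((z - \<rho> *\<^sub>R b) - g a)"
    and "W \<equiv> \<rho> *\<^sub>R (b - a) - ((z - \<rho> *\<^sub>R b) - g a)"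
  shows "(1 / \<eta> - \<theta> * \<mu> * \<phi>) / (2 * real K) * (norm (y K - a))\<^sup>2 + (1 / (4 * \<rho>) + d / 2) * (norm W)\<^sup>2
    \<le> (1 / \<eta> - \<theta> * \<mu>) / (2 * real K) * (norm (y 0 - a))\<^sup>2 + (1 / (4 * \<rho>) - d / 2) * (norm Z)\<^sup>2"
proof -
  define n where "n = real K"
  have n: "n > 0" using \<open>K \<ge> 1\<close> by (simp add: n_def)
  define E where "E k = (norm (y k - a))\<^sup>2" for k
  define S where "S = (\<Sum>k=1..K. E k)"
  define l where "l k = z - \<rho> *\<^sub>R y k - g a" for k
  define h where "h = z - \<rho> *\<^sub>R b - g a"
  define e where "e = b - a"
  have Z: "Z = \<rho> *\<^sub>R e + h" and W: "W = \<rho> *\<^sub>R e - h" by (simp_all add: Z_def W_def e_def h_def)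
  have sum_y: "(\<Sum>k=1..K. y k) = n *\<^sub>R b" using n by (simp add: b_def n_def)
  have mean_e: "(1 / n) *\<^sub>R (\<Sum>k=1..K. y k - a) = e"
    using n by (simp add: sum_subtractf sum_y[unfolded One_nat_def] e_def n_def sum_constant_scaleR scaleR_diff_right del: sum_constant)
  \<comment> \<open>Since \<open>l k\<close> is affine in \<open>y k\<close>, its mean is the dual
    error \<open>h\<close> at the averaged iterate.\<close>
  have mean_l: "(1 / n) *\<^sub>R (\<Sum>k=1..K. l k) = h"
    using n by (simp add: l_def sum_subtractf scaleR_sum_right[symmetric] sum_y[unfolded One_nat_def] h_def n_def
        sum_constant_scaleR scaleR_diff_right del: sum_constant)
  have S_ge: "n * (norm e)\<^sup>2 \<le> S"
    using norm_mean_power2_le[of "{1..K}" "\<lambda>k. y k - a"] \<open>K \<ge> 1\<close>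
    unfolding S_def E_def mean_e[symmetric] n_def by simp
  have l_ge: "n * (norm h)\<^sup>2 \<le> (\<Sum>k=1..K. (norm (l k))\<^sup>2)"
    using norm_mean_power2_le[of "{1..K}" l] \<open>K \<ge> 1\<close>
    unfolding mean_l[symmetric] n_def by simp
  have inner_le: "(\<Sum>k=1..K. l k \<bullet> (y k - a)) \<le> n * (h \<bullet> e)"
  proof -
    \<comment> \<open>Writing \<open>l k\<close> as \<open>h + \<rho> *\<^sub>R e\<close> minus
      \<open>\<rho> *\<^sub>R (y k - a)\<close> shows that the sum equals
      \<open>n * (h \<bullet> e)\<close> minus \<open>\<rho>\<close> times the spread of the
      iterates about their mean.\<close>
    have "l k \<bullet> (y k - a) = (h + \<rho> *\<^sub>R e) \<bullet> (y k - a) - \<rho> * E k" for k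
      by (simp add: l_def h_def e_def E_def power2_norm_eq_inner inner_diff_left inner_diff_right
          inner_add_left inner_commute algebra_simps)
    then have "(\<Sum>k=1..K. l k \<bullet> (y k - a))
        = (\<Sum>k=1..K. (h + \<rho> *\<^sub>R e) \<bullet> (y k - a)) - (\<Sum>k=1..K. \<rho> * E k)"
      by (simp only: sum_subtractf)
    also have "\<dots> = (h + \<rho> *\<^sub>R e) \<bullet> (\<Sum>k=1..K. y k - a) - \<rho> * S"
      by (simp only: inner_sum_right S_def sum_distrib_left)
    also have "(\<Sum>k=1..K. y k - a) = n *\<^sub>R e" unfolding mean_e[symmetric] using n by simp
    also have "(h + \<rho> *\<^sub>R e) \<bullet> (n *\<^sub>R e) - \<rho> * S = n * (h \<bullet> e) - \<rho> * (S - n * (norm e)\<^sup>2)"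
      by (simp add: inner_add_left power2_norm_eq_inner algebra_simps)
    also have "\<dots> \<le> n * (h \<bullet> e)" using S_ge \<open>\<rho> > 0\<close> by simp
    finally show ?thesis .
  qed
  have step_ge: "l (Suc k) \<bullet> (y (Suc k) - a)
      \<ge> (1 / \<eta> - \<theta> * \<mu>) / 2 * (E (Suc k) - E k) + \<theta> * \<mu> / 2 * E (Suc k) + d * (norm (l (Suc k)))\<^sup>2"
    if "k < K" for k
  proof -
    have "g (y k) - g a = (1 / \<eta>) *\<^sub>R (y k - y (Suc k)) + l (Suc k)"
      using step[OF that] by (simp add: l_def)
    from client_step[OF adm _ _ _ _ _ _ _ _ this] assms
    have "l (Suc k) \<bullet> (y (Suc k) - a) \<ge> 1 / (2 * \<eta>) * E (Suc k) - (1 / \<eta> - \<theta> * \<mu>) / 2 * E k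
        + c * \<eta>\<^sup>2 / 2 * (norm (l (Suc k)))\<^sup>2"
      unfolding E_def by blast
    moreover have "d * (norm (l (Suc k)))\<^sup>2 \<le> c * \<eta>\<^sup>2 / 2 * (norm (l (Suc k)))\<^sup>2"
      using d2 by (intro mult_right_mono) auto
    ultimately show ?thesis by (simp add: algebra_simps diff_divide_distrib)
  qed
  have reindex: "(\<Sum>k<K. F (Suc k)) = (\<Sum>k=1..K. F k)" for F :: "nat \<Rightarrow> real"
    by (simp add: sum.atLeast1_atMost_eq)
  have "(1 / \<eta> - \<theta> * \<mu>) / 2 * (E K - E 0) + \<theta> * \<mu> / 2 * S + d * (\<Sum>k=1..K. (norm (l k))\<^sup>2)
      = (\<Sum>k<K. (1 / \<eta> - \<theta> * \<mu>) / 2 * (E (Suc k) - E k) + \<theta> * \<mu> / 2 * E (Suc k)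
          + d * (norm (l (Suc k)))\<^sup>2)"
    unfolding sum.distrib sum_distrib_left[symmetric] sum_lessThan_telescope S_def
    by (simp only: reindex[of E] reindex[of "\<lambda>k. (norm (l k))\<^sup>2"])
  also have "\<dots> \<le> (\<Sum>k<K. l (Suc k) \<bullet> (y (Suc k) - a))"
    using step_ge by (intro sum_mono) auto
  also have "\<dots> \<le> n * (h \<bullet> e)" using inner_le by (simp only: reindex[of "\<lambda>k. l k \<bullet> (y k - a)"])
  finally have main: "(1 / \<eta> - \<theta> * \<mu>) / 2 * (E K - E 0) + \<theta> * \<mu> / 2 * S
      + d * (\<Sum>k=1..K. (norm (l k))\<^sup>2) \<le> n * (h \<bullet> e)" .
  have "E K \<le> S" unfolding S_def
    using \<open>K \<ge> 1\<close> by (intro member_le_sum) (auto simp: E_def)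
  \<comment> \<open>The surplus \<open>\<theta> * \<mu> / 2 * S\<close> is split by
    \<open>\<phi>\<close>. This share turns the coefficient
    \<open>1 / \<eta> - \<theta> * \<mu>\<close> of \<open>E K\<close> into
    \<open>1 / \<eta> - \<theta> * \<mu> * \<phi>\<close>.\<close>
  then have "(1 - \<phi>) * (\<theta> * \<mu> / 2) * E K \<le> (1 - \<phi>) * (\<theta> * \<mu> / 2) * S"
    using assms by (intro mult_left_mono) auto
  \<comment> \<open>The other share pays for the primal half of the quadratic term; this is the
    origin of the first entry in the minimum \<open>gamma2\<close>.\<close>
  moreover have "n * (d * \<rho>\<^sup>2 * (norm e)\<^sup>2) \<le> \<phi> * (\<theta> * \<mu> / 2) * S"
  proof -
    have "d * \<rho>\<^sup>2 \<le> \<phi> * (\<theta> * \<mu> / 2)"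
      using d1 \<open>\<rho> > 0\<close> by (simp add: field_simps)
    then have "d * \<rho>\<^sup>2 * (n * (norm e)\<^sup>2) \<le> \<phi> * (\<theta> * \<mu> / 2) * S"
      by (rule mult_mono) (use S_ge n \<open>0 \<le> \<phi>\<close> \<open>0 \<le> \<theta>\<close> \<open>\<mu> \<ge> 0\<close> in auto)
    then show ?thesis by (simp add: algebra_simps)
  qed
  moreover have "n * (d * (norm h)\<^sup>2) \<le> d * (\<Sum>k=1..K. (norm (l k))\<^sup>2)"
    using mult_left_mono[OF l_ge \<open>d \<ge> 0\<close>] by (simp add: algebra_simps)
  ultimately have "(1 / \<eta> - \<theta> * \<mu> * \<phi>) / 2 * E K - (1 / \<eta> - \<theta> * \<mu>) / 2 * E 0
      + n * (d * (\<rho>\<^sup>2 * (norm e)\<^sup>2 + (norm h)\<^sup>2)) \<le> n * (h \<bullet> e)"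
    using main by (simp add: algebra_simps diff_divide_distrib)
  then have divided: "((1 / \<eta> - \<theta> * \<mu> * \<phi>) / 2 * E K - (1 / \<eta> - \<theta> * \<mu>) / 2 * E 0
      + n * (d * (\<rho>\<^sup>2 * (norm e)\<^sup>2 + (norm h)\<^sup>2))) / n \<le> n * (h \<bullet> e) / n"
    using n by (intro divide_right_mono) auto
  have round: "(1 / \<eta> - \<theta> * \<mu> * \<phi>) / (2 * n) * E K - (1 / \<eta> - \<theta> * \<mu>) / (2 * n) * E 0
      + d * (\<rho>\<^sup>2 * (norm e)\<^sup>2 + (norm h)\<^sup>2) \<le> h \<bullet> e"
  proof -
    have "(p / 2 * q - p' / 2 * q' + n * k) / n = p / (2 * n) * q - p' / (2 * n) * q' + k"
      for p q p' q' k :: real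
      using n by (simp add: field_simps)
    with divided show ?thesis using n by simp
  qed
  have "h \<bullet> e = 1 / (4 * \<rho>) * ((norm Z)\<^sup>2 - (norm W)\<^sup>2)"
    using \<open>\<rho> > 0\<close> unfolding Z W power2_norm_eq_inner
    by (simp add: inner_diff_left inner_diff_right inner_add_left inner_add_right inner_commute field_simps)
  moreover have parallelogram: "\<rho>\<^sup>2 * (norm e)\<^sup>2 + (norm h)\<^sup>2 = ((norm Z)\<^sup>2 + (norm W)\<^sup>2) / 2"
    unfolding Z W power2_norm_eq_inner
    by (simp add: inner_diff_left inner_diff_right inner_add_left inner_add_right inner_commute
        power2_eq_square)
  \<comment> \<open>The parallelogram term lowers the coefficient of the square of \<open>Z\<close>
    and raises that of \<open>W\<close>, each by \<open>d / 2\<close>.\<close>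
  ultimately show ?thesis using round[unfolded parallelogram]
    unfolding E_def n_def by (simp add: algebra_simps add_divide_distrib)
qed

section \<open>Signs of the constants and of the rate\<close>

text \<open>The chain \<open>\<theta> * \<mu> < \<mu> \<le> L < 1 / \<eta>\<close> controls the
  primal coefficients, and the last hypothesis bounds \<open>gamma2\<close> through the first entry
  of its minimum.\<close>

lemma beta_rate_bounds:
  fixes L \<mu> \<eta> \<rho> \<theta> \<phi> :: real
  assumes "\<rho> > 0" and "\<eta> > 0" and "1 / \<eta> > L" and "L \<ge> \<mu>" and "\<mu> > 0"
    and "0 < \<theta>" and "\<theta> < 1" and "0 < \<phi>" and "\<phi> < 1"
    and "\<theta> * \<mu> * \<phi> / (4 * \<rho>\<^sup>2) < 1 / (4 * \<rho>)"
  shows "gamma1 L \<eta> \<theta> > 0" and "gamma2 L \<mu> \<eta> \<rho> \<theta> \<phi> > 0"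
    and "gamma2 L \<mu> \<eta> \<rho> \<theta> \<phi> / 2 < 1 / (4 * \<rho>)"
    and "\<theta> * \<mu> < 1 / \<eta>" and "\<theta> * \<mu> * \<phi> < \<theta> * \<mu>"
    and "0 < beta_rate L \<mu> \<eta> \<rho> \<theta> \<phi>" and "beta_rate L \<mu> \<eta> \<rho> \<theta> \<phi> < 1"
proof -
  show g1: "gamma1 L \<eta> \<theta> > 0" using assms by (simp add: gamma1_def)
  show g2: "gamma2 L \<mu> \<eta> \<rho> \<theta> \<phi> > 0" using assms g1 by (simp add: gamma2_def)
  have "gamma2 L \<mu> \<eta> \<rho> \<theta> \<phi> \<le> \<theta> * \<mu> * \<phi> / (2 * \<rho>\<^sup>2)" by (simp add: gamma2_def)
  then show B: "gamma2 L \<mu> \<eta> \<rho> \<theta> \<phi> / 2 < 1 / (4 * \<rho>)" using assms(10) by simp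
  have "\<theta> * \<mu> < 1 * \<mu>" using assms by (intro mult_strict_right_mono) auto
  then show A: "\<theta> * \<mu> < 1 / \<eta>" using assms by linarith
  show AP: "\<theta> * \<mu> * \<phi> < \<theta> * \<mu>" using assms by simp
  have "(1 / (4 * \<rho>) - gamma2 L \<mu> \<eta> \<rho> \<theta> \<phi> / 2) / (1 / (4 * \<rho>)) > 0"
    using B \<open>\<rho> > 0\<close> by (intro divide_pos_pos) auto
  then show "0 < beta_rate L \<mu> \<eta> \<rho> \<theta> \<phi>"
    unfolding beta_rate_def by (simp add: less_max_iff_disj)
  have "(1 / (4 * \<rho>) - gamma2 L \<mu> \<eta> \<rho> \<theta> \<phi> / 2) / (1 / (4 * \<rho>)) < 1"
    using g2 \<open>\<rho> > 0\<close> by (subst divide_less_eq_1_pos) auto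
  moreover have "(1 / \<eta> - \<theta> * \<mu>) / (1 / \<eta> - \<theta> * \<mu> * \<phi>) < 1"
    using A AP by (subst divide_less_eq_1_pos) auto
  ultimately show "beta_rate L \<mu> \<eta> \<rho> \<theta> \<phi> < 1"
    unfolding beta_rate_def by simp
qed

section \<open>Contraction over one full round\<close>

theorem theorem1:
  fixes m K :: nat
    and L \<mu> \<eta> \<rho> \<theta> \<phi> :: real
    and f :: "nat \<Rightarrow> real ^ 'd \<Rightarrow> real"
    and g :: "nat \<Rightarrow> real ^ 'd \<Rightarrow> real ^ 'd"
    and x :: "nat \<Rightarrow> nat \<Rightarrow> nat \<Rightarrow> real ^ 'd"
    and xs :: "nat \<Rightarrow> real ^ 'd"
    and lam_is lam_si :: "nat \<Rightarrow> nat \<Rightarrow> real ^ 'd"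
    and xs_opt :: "real ^ 'd"
    and x_opt lam_opt :: "nat \<Rightarrow> real ^ 'd"
  assumes "m \<ge> 1" and "K \<ge> 1" and "\<rho> > 0" and "\<eta> > 0"
    and "1 / \<eta> > L" and "L \<ge> \<mu>" and "\<mu> > 0"
    and "\<And>i. i \<in> {1..m} \<Longrightarrow> admissible_objective L \<mu> (f i) (g i)"
    and "kkt m g xs_opt x_opt lam_opt"
    and "gpdmm_run m K \<eta> \<rho> g x xs lam_is lam_si"
    and "0 < \<theta>" and "\<theta> < 1" and "0 < \<phi>" and "\<phi> < 1"
    and "\<theta> * \<mu> * \<phi> / (4 * \<rho>\<^sup>2) < 1 / (4 * \<rho>)"
  shows "(\<forall>r\<ge>1. Q_fun m K L \<mu> \<eta> \<rho> \<theta> \<phi> x lam_is x_opt lam_opt (r + 1)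
            \<le> beta_rate L \<mu> \<eta> \<rho> \<theta> \<phi> * Q_fun m K L \<mu> \<eta> \<rho> \<theta> \<phi> x lam_is x_opt lam_opt r)
         \<and> 0 < beta_rate L \<mu> \<eta> \<rho> \<theta> \<phi> \<and> beta_rate L \<mu> \<eta> \<rho> \<theta> \<phi> < 1"
proof (intro conjI allI impI)
  note bnd = beta_rate_bounds[OF assms(3-7) assms(11-15)]
  show "0 < beta_rate L \<mu> \<eta> \<rho> \<theta> \<phi>" and "beta_rate L \<mu> \<eta> \<rho> \<theta> \<phi> < 1"
    using bnd by auto
  fix r :: nat
  assume r: "r \<ge> 1"
  define I where "I = {1..m}"
  have I: "finite I" "I \<noteq> {}" "card I = m" using \<open>m \<ge> 1\<close> by (auto simp: I_def)
  define \<beta> where "\<beta> = beta_rate L \<mu> \<eta> \<rho> \<theta> \<phi>"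
  define d where "d = gamma2 L \<mu> \<eta> \<rho> \<theta> \<phi>"
  define A where "A = (1 / \<eta> - \<theta> * \<mu>) / (2 * real K)"
  \<comment> \<open>\<open>A\<close> and \<open>B\<close> are the coefficients in
    \<open>Q_fun\<close>; \<open>A'\<close> and \<open>D\<close> are the larger ones that a round
    yields at its end.\<close>
  define A' where "A' = (1 / \<eta> - \<theta> * \<mu> * \<phi>) / (2 * real K)"
  define B where "B = 1 / (4 * \<rho>) - d / 2"
  define D where "D = 1 / (4 * \<rho>) + d / 2"
  define b where "b s i = client_avg K x i s" for s i
  define Z where "Z s i = \<rho> *\<^sub>R (b s i - x_opt i) + (lam_is i (s + 1) - lam_opt i)" for s i
  define W where "W i = \<rho> *\<^sub>R (b r i - x_opt i) - (lam_is i (r + 1) - lam_opt i)" for i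
  define X where "X s i = (norm (x i s K - x_opt i))\<^sup>2" for s i
  have Q: "Q_fun m K L \<mu> \<eta> \<rho> \<theta> \<phi> x lam_is x_opt lam_opt s
      = A * (\<Sum>i\<in>I. X (s - 1) i) + B * (\<Sum>i\<in>I. (norm (Z s i))\<^sup>2)" for s
    by (simp add: Q_fun_def I_def A_def B_def X_def Z_def b_def d_def sum.distrib sum_distrib_left)
  have opt: "x_opt i = xs_opt" "g i (x_opt i) = lam_opt i" if "i \<in> I" for i
    using assms(9) that by (auto simp: kkt_def I_def)
  have sum_lam_opt: "(\<Sum>i\<in>I. lam_opt i) = 0"
    using assms(9) by (auto simp: kkt_def I_def)
  have start: "x i s 0 = x i (s - 1) K"
    and local: "k < K \<Longrightarrow> x i s (k + 1) = x i s k - (1 / (1 / \<eta> + \<rho>)) *\<^sub>R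
              (g i (x i s k) + \<rho> *\<^sub>R (x i s k - xs s) + lam_si i s)"
    and lam: "lam_is i (s + 1) = \<rho> *\<^sub>R (xs s - b s i) - lam_si i s"
    and lam_si: "lam_si i (s + 1) = \<rho> *\<^sub>R (b s i - xs (s + 1)) - lam_is i (s + 1)"
    and server: "xs (s + 1) = (1 / real m) *\<^sub>R (\<Sum>i\<in>I. b s i - (1 / \<rho>) *\<^sub>R lam_is i (s + 1))"
    if "i \<in> I" "s \<ge> 1" for i s k
    using assms(10) that unfolding gpdmm_run_def I_def b_def by auto
  have c1: "gamma1 L \<eta> \<theta> \<le> (1 - \<theta>) / (2 * L * \<eta>\<^sup>2)" and c2: "gamma1 L \<eta> \<theta> \<le> (1 / \<eta> - L) / 2"
    by (simp_all only: gamma1_def min.cobounded1 min.cobounded2)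
  have d1: "d \<le> \<theta> * \<mu> * \<phi> / (2 * \<rho>\<^sup>2)" and d2: "d \<le> gamma1 L \<eta> \<theta> * \<eta>\<^sup>2 / 2"
    by (simp_all only: d_def gamma2_def min.cobounded1 min.cobounded2)
  have client: "A' * X r i + D * (norm (W i))\<^sup>2
      \<le> A * X (r - 1) i + B * (norm (Z r i))\<^sup>2" if i: "i \<in> I" for i
  proof -
    define z where "z = \<rho> *\<^sub>R xs r - lam_si i r"
    have lz: "lam_is i (r + 1) = z - \<rho> *\<^sub>R b r i"
      using lam[OF i r] by (simp add: z_def algebra_simps)
    have "g i (x i r k) = (1 / \<eta>) *\<^sub>R (x i r k - x i r (Suc k)) + (z - \<rho> *\<^sub>R x i r (Suc k))"
      if "k < K" for k
    proof -
      have "1 / \<eta> + \<rho> > 0" using assms by (simp add: add_pos_pos)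
      \<comment> \<open>With the step size cleared, moving
        \<open>\<rho> *\<^sub>R (x i r k - x i r (k + 1))\<close> across evaluates the penalty at
        the new iterate.\<close>
      then have "(1 / \<eta> + \<rho>) *\<^sub>R (x i r k - x i r (k + 1))
          = g i (x i r k) + \<rho> *\<^sub>R (x i r k - xs r) + lam_si i r"
        unfolding local[OF i r that] by simp
      then show ?thesis by (simp add: z_def algebra_simps)
    qed
    then have "(1 / \<eta> - \<theta> * \<mu> * \<phi>) / (2 * real K) * (norm (x i r K - x_opt i))\<^sup>2
        + (1 / (4 * \<rho>) + d / 2)
          * (norm (\<rho> *\<^sub>R (b r i - x_opt i) - ((z - \<rho> *\<^sub>R b r i) - g i (x_opt i))))\<^sup>2
      \<le> (1 / \<eta> - \<theta> * \<mu>) / (2 * real K) * (norm (x i r 0 - x_opt i))\<^sup>2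
        + (1 / (4 * \<rho>) - d / 2)
          * (norm (\<rho> *\<^sub>R (b r i - x_opt i) + ((z - \<rho> *\<^sub>R b r i) - g i (x_opt i))))\<^sup>2"
      using assms(2-7,11-14) bnd(1,2)[folded d_def] assms(8)[OF i[unfolded I_def]] c1 c2 d1 d2
      by (intro client_round[where c = "gamma1 L \<eta> \<theta>" and L = L and f = "f i"])
        (auto simp: b_def client_avg_def simp del: divide_le_eq_numeral1 le_divide_eq_numeral1)
    then show ?thesis
      using start[OF i r] opt(2)[OF i] lz
      by (simp add: A_def A'_def B_def D_def X_def W_def Z_def)
  qed
  have reflect: "(\<Sum>i\<in>I. (norm (Z (r + 1) i))\<^sup>2) = (\<Sum>i\<in>I. (norm (W i))\<^sup>2)"
  proof -
    define c where "c = (1 / real m) *\<^sub>R sum W I"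
    \<comment> \<open>The optimal duals sum to zero, so the mean of \<open>W\<close> is the scaled
      server error.\<close>
    have "c = \<rho> *\<^sub>R (xs (r + 1) - xs_opt)"
    proof -
      have "sum W I = (\<Sum>i\<in>I. \<rho> *\<^sub>R (b r i - (1 / \<rho>) *\<^sub>R lam_is i (r + 1)) - \<rho> *\<^sub>R xs_opt + lam_opt i)"
        using \<open>\<rho> > 0\<close> by (intro sum.cong refl) (simp add: W_def opt algebra_simps)
      also have "\<dots> = \<rho> *\<^sub>R (\<Sum>i\<in>I. b r i - (1 / \<rho>) *\<^sub>R lam_is i (r + 1)) - real m *\<^sub>R (\<rho> *\<^sub>R xs_opt)"
        by (simp only: sum.distrib sum_subtractf sum_lam_opt sum_constant_scaleR I(3)
            scaleR_sum_right[symmetric] add_0_right)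
      \<comment> \<open>\<open>server\<close> was stated under a membership premise, hence the
        appeal to nonemptiness of \<open>I\<close>.\<close>
      finally show ?thesis
        using server[OF _ r] I(2) \<open>m \<ge> 1\<close>
        by (auto simp: c_def scaleR_diff_right scaleR_left_commute)
    qed
    \<comment> \<open>The average of round \<open>r + 1\<close> cancels in
      \<open>Z (r + 1) i\<close>, which therefore depends only on the state at the end of round
      \<open>r\<close>.\<close>
    moreover have "Z (r + 1) i = 2 *\<^sub>R (\<rho> *\<^sub>R (xs (r + 1) - xs_opt)) - W i" if i: "i \<in> I" for i
    proof -
      have "r + 1 \<ge> 1" by simp
      show ?thesis
        unfolding Z_def W_def opt(1)[OF i] lam[OF i \<open>r + 1 \<ge> 1\<close>] lam_si[OF i r]
        by (simp only: scaleR_2 scaleR_diff_right) simp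
    qed
    ultimately show ?thesis
      using sum_norm_power2_reflect_mean[OF I(1,2), of W] by (simp add: I(3) c_def[symmetric])
  qed
  have \<beta>0: "\<beta> > 0" using bnd by (simp add: \<beta>_def)
  have "\<beta> * A' \<ge> A"
  proof -
    have "1 / \<eta> - \<theta> * \<mu> * \<phi> > 0" using bnd(4,5) by linarith
    moreover have "(1 / \<eta> - \<theta> * \<mu>) / (1 / \<eta> - \<theta> * \<mu> * \<phi>) \<le> \<beta>" by (simp add: \<beta>_def beta_rate_def)
    ultimately have "1 / \<eta> - \<theta> * \<mu> \<le> \<beta> * (1 / \<eta> - \<theta> * \<mu> * \<phi>)" by (simp add: pos_divide_le_eq)
    then show ?thesis
      unfolding A_def A'_def by (simp add: divide_right_mono del: divide_le_cancel)
  qed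
  \<comment> \<open>The first entry of the maximum compares \<open>B\<close> with
    \<open>1 / (4 * \<rho>)\<close>, and \<open>D\<close> exceeds the latter by
    \<open>d / 2\<close>.\<close>
  moreover have "\<beta> * D \<ge> B"
  proof -
    have "B / (1 / (4 * \<rho>)) \<le> \<beta>" by (simp add: \<beta>_def beta_rate_def B_def d_def)
    then have "B \<le> \<beta> * (1 / (4 * \<rho>))"
      using \<open>\<rho> > 0\<close> by (subst (asm) pos_divide_le_eq) auto
    moreover have "\<beta> * (d / 2) \<ge> 0" using \<beta>0 bnd(2) by (simp add: d_def)
    ultimately show ?thesis by (simp add: D_def distrib_left)
  qed
  \<comment> \<open>By \<open>reflect\<close>, the left side is \<open>Q_fun\<close> at
    \<open>r + 1\<close>, whose primal part carries the index \<open>r\<close>.\<close>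
  ultimately have "A * (\<Sum>i\<in>I. X r i) + B * (\<Sum>i\<in>I. (norm (W i))\<^sup>2)
      \<le> \<beta> * A' * (\<Sum>i\<in>I. X r i) + \<beta> * D * (\<Sum>i\<in>I. (norm (W i))\<^sup>2)"
    by (intro add_mono mult_right_mono sum_nonneg) (auto simp: X_def)
  also have "\<dots> = \<beta> * (\<Sum>i\<in>I. A' * X r i + D * (norm (W i))\<^sup>2)"
    by (simp only: sum.distrib sum_distrib_left[symmetric] distrib_left mult.assoc)
  also have "\<dots> \<le> \<beta> * (\<Sum>i\<in>I. A * X (r - 1) i + B * (norm (Z r i))\<^sup>2)"
    using client \<beta>0 by (intro mult_left_mono sum_mono) auto
  also have "\<dots> = \<beta> * (A * (\<Sum>i\<in>I. X (r - 1) i) + B * (\<Sum>i\<in>I. (norm (Z r i))\<^sup>2))"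
    by (simp only: sum.distrib sum_distrib_left[symmetric])
  finally show "Q_fun m K L \<mu> \<eta> \<rho> \<theta> \<phi> x lam_is x_opt lam_opt (r + 1)
      \<le> beta_rate L \<mu> \<eta> \<rho> \<theta> \<phi> * Q_fun m K L \<mu> \<eta> \<rho> \<theta> \<phi> x lam_is x_opt lam_opt r"
    unfolding Q reflect by (simp add: \<beta>_def)
qed

end
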